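(* Let $(M,\langle\cdot,\cdot\rangle)$ be a Riemannian manifold, let $R:TM\to M$ be a retraction on $M$, and let $f:M\to\mathbb R$ be bounded below and of class $C^1$. Suppose there exists a constant $L>0$ such that $$|\mathrm{D}(f\circ R_x)(t\eta)[\eta]-\mathrm{D}(f\circ R_x)(0)[\eta]|\le Lt$$ for all $x\in M$, all $\eta\in T_xM$ with $\|\eta\|_x=1$, and all $t\ge 0$. Let $0<c_1<c_2<1$, and let $\{x_k\}_{k\ge 0}$ be a sequence generated by the scaled Dai--Yuan-type Riemannian conjugate gradient method (defined in the context) applied to $f$ with retraction $R$ and constants $c_1,c_2$, from an arbitrary initial point $x_0\in M$. Then $$\liminf_{k\to\infty}\|\operatorname{grad} f(x_k)\|_{x_k}=0.$$
   Context: Notation. $\langle\cdot,\cdot\rangle_x$ is the Riemannian inner product on $T_xM$, $\|\xi\|_x=\sqrt{\langle\xi,\xi\rangle_x}$, and $\operatorname{grad} f$ is the Riemannian gradient of $f$. Retraction. A retraction on $M$ is a smooth map $R:TM\to M$ such that, with $R_x$ the restriction of $R$ to $T_xM$, for every $x\in M$: (i) $R_x(0_x)=x$, where $0_x$ is the zero of $T_xM$; (ii) with the canonical identification $T_{0_x}T_xM\simeq T_xM$, $\mathrm{D}R_x(0_x)=\mathrm{id}_{T_xM}$. Differentiated retraction and scaled vector transport. For $x\in M$ and $\eta,\xi\in T_xM$, $$\mathcal T^R_\eta(\xi)=\mathrm{D}R_x(\eta)[\xi]\in T_{R_x(\eta)}M,\qquad \mathcal T^0_\eta(\xi)=\frac{\|\xi\|_x}{\|\mathcal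 T^R_\eta(\xi)\|_{R_x(\eta)}}\,\mathcal T^R_\eta(\xi)\quad(\text{when }\mathcal T^R_\eta(\xi)\ne 0).$$ Scaled Dai--Yuan-type Riemannian conjugate gradient method. Choose $x_0\in M$ and set $\eta_0=-\operatorname{grad} f(x_0)$. For $k=0,1,2,\dots$: (a) The step size $\alpha_k>0$ is any number satisfying the weak Wolfe conditions $$f(R_{x_k}(\alpha_k\eta_k))\le f(x_k)+c_1\alpha_k\langle\operatorname{grad} f(x_k),\eta_k\rangle_{x_k},$$ $$\langle\operatorname{grad} f(R_{x_k}(\alpha_k\eta_k)),\mathrm{D}R_{x_k}(\alpha_k\eta_k)[\eta_k]\rangle_{R_{x_k}(\alpha_k\eta_k)}\ge c_2\langle\operatorname{grad} f(x_k),\eta_k\rangle_{x_k},$$ and $x_{k+1}=R_{x_k}(\alpha_k\eta_k)$. (b) Define $$\mathcal T^{(k)}_{\alpha_k\eta_k}(\eta_k)=\begin{cases}\mathcal T^R_{\alpha_k\eta_k}(\eta_k)&\text{if }\|\mathcal T^R_{\alpha_k\eta_k}(\eta_k)\|_{x_{k+1}}\le\|\eta_k\|_{x_k},\\ \mathcal T^0_{\alpha_k\eta_k}(\eta_k)&\text{otherwise,}\end{cases}$$ $$\beta_{k+1}=\frac{\|\operatorname{grad} f(x_{k+1})\|_{x_{k+1}}^2}{\langle\operatorname{grad} f(x_{k+1}),\mathcal T^{(k)}_{\alpha_k\eta_k}(\eta_k)\rangle_{x_{k+1}}-\langle\operatorname{grad} f(x_k),\eta_k\rangle_{x_k}},$$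 $$\eta_{k+1}=-\operatorname{grad} f(x_{k+1})+\beta_{k+1}\mathcal T^{(k)}_{\alpha_k\eta_k}(\eta_k).$$ Convention: if $\operatorname{grad} f(x_{k+1})=0$, then $\beta_{k+1}=0$ (so $\eta_{k+1}=0$ and the sequence is constant from $x_{k+1}$ on). *)

theory Defs
  imports "HOL-Analysis.Analysis"
begin

text \<open>
  Only used for open sets in finite-dimensional spaces, where continuity of all iterated
  directional derivatives is the usual notion of being of class \<open>C\<^sup>k\<close>.
\<close>

primrec higher_differentiable_on ::
    "nat \<Rightarrow> 'a::real_normed_vector set \<Rightarrow> ('a \<Rightarrow> 'b::real_normed_vector) \<Rightarrow> bool" where
  "higher_differentiable_on 0 S f \<longleftrightarrow> continuous_on S f"
| "higher_differentiable_on (Suc k) S f \<longleftrightarrow>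
     (\<forall>x\<in>S. f differentiable (at x)) \<and>
     (\<forall>v. higher_differentiable_on k S (\<lambda>x. frechet_derivative f (at x) v))"

definition smooth_on :: "'a::real_normed_vector set \<Rightarrow> ('a \<Rightarrow> 'b::real_normed_vector) \<Rightarrow> bool" where
  "smooth_on S f \<longleftrightarrow> (\<forall>k. higher_differentiable_on k S f)"

text \<open>
  A manifold is a whole type \<open>'m\<close> (Hausdorff and second countable by its type class) together with
  a \<open>C\<^sup>\<infinity>\<close> atlas.  The model space \<open>'e\<close> is an arbitrary finite-dimensional real normed space; the
  class \<open>euclidean_space\<close> would exclude manifolds of dimension \<open>0\<close>.
\<close>

type_synonym ('m, 'e) chart = "'m set \<times> ('m \<Rightarrow> 'e)"

definition chart_dom :: "('m, 'e) chart \<Rightarrow> 'm set" where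
  "chart_dom c = fst c"

definition chart_map :: "('m, 'e) chart \<Rightarrow> 'm \<Rightarrow> 'e" where
  "chart_map c = snd c"

definition chart_range :: "('m, 'e) chart \<Rightarrow> 'e set" where
  "chart_range c = chart_map c ` chart_dom c"

definition chart_inv :: "('m, 'e) chart \<Rightarrow> 'e \<Rightarrow> 'm" where
  "chart_inv c = inv_into (chart_dom c) (chart_map c)"

definition is_chart :: "('m::topological_space, 'e::real_normed_vector) chart \<Rightarrow> bool" where
  "is_chart c \<longleftrightarrow>
     open (chart_dom c) \<and> open (chart_range c) \<and>
     homeomorphism (chart_dom c) (chart_range c) (chart_map c) (chart_inv c)"

definition smooth_manifold ::
    "('m::{t2_space, second_countable_topology}, 'e::real_normed_vector) chart set \<Rightarrow> bool" where
  "smooth_manifold A \<longleftrightarrow>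
     (\<exists>B::'e set. finite B \<and> span B = UNIV) \<and>
     (\<forall>c\<in>A. is_chart c) \<and>
     (\<Union>c\<in>A. chart_dom c) = UNIV \<and>
     (\<forall>c\<in>A. \<forall>d\<in>A. smooth_on (chart_map c ` (chart_dom c \<inter> chart_dom d)) (chart_map d \<circ> chart_inv c))"

text \<open>
  Tangent vectors at \<open>x\<close> are equivalence classes of pairs (chart around \<open>x\<close>, vector in \<open>'e\<close>) modulo
  the derivatives of the coordinate changes.  Each class has exactly one representative in any given
  chart around \<open>x\<close>.  We fix one chart \<open>chart_at A x\<close> for each point \<open>x\<close> and represent
  \<open>T\<^sub>xM\<close> by the vector space \<open>'e\<close>, through that chart; thus \<open>TM\<close> is
  \<open>'m \<times> 'e\<close> as a set.  Its manifold structure, given by the charts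
  \<open>(x, v) \<mapsto> (\<phi>(x), D(\<phi> \<circ> chart_at(x)\<^sup>-\<^sup>1) v)\<close> with \<open>\<phi>\<close> in the atlas,
  does not depend on the choice of \<open>chart_at\<close> (which need not vary continuously with \<open>x\<close>), and all
  smoothness conditions below are expressed in these charts.
\<close>

definition chart_at :: "('m, 'e) chart set \<Rightarrow> 'm \<Rightarrow> ('m, 'e) chart" where
  "chart_at A x = (SOME c. c \<in> A \<and> x \<in> chart_dom c)"

text \<open>The tangent vector at \<open>x\<close> whose coordinates with respect to the chart \<open>c\<close> are \<open>w\<close>.\<close>

definition tangent_of ::
    "('m, 'e::real_normed_vector) chart set \<Rightarrow> ('m, 'e) chart \<Rightarrow> 'm \<Rightarrow> 'e \<Rightarrow> 'e" where
  "tangent_of A c x w =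
     frechet_derivative (chart_map (chart_at A x) \<circ> chart_inv c) (at (chart_map c x)) w"

definition C1_function ::
    "('m, 'e::real_normed_vector) chart set \<Rightarrow> ('m \<Rightarrow> real) \<Rightarrow> bool" where
  "C1_function A f \<longleftrightarrow> (\<forall>c\<in>A. higher_differentiable_on 1 (chart_range c) (f \<circ> chart_inv c))"

definition differential ::
    "('m, 'e::real_normed_vector) chart set \<Rightarrow> ('m \<Rightarrow> real) \<Rightarrow> 'm \<Rightarrow> 'e \<Rightarrow> real" where
  "differential A f x v =
     frechet_derivative (f \<circ> chart_inv (chart_at A x)) (at (chart_map (chart_at A x) x)) v"

definition riemannian_metric ::
    "('m, 'e::real_normed_vector) chart set \<Rightarrow> ('m \<Rightarrow> 'e \<Rightarrow> 'e \<Rightarrow> real) \<Rightarrow> bool" where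
  "riemannian_metric A g \<longleftrightarrow>
     (\<forall>x. bilinear (g x)) \<and>
     (\<forall>x v w. g x v w = g x w v) \<and>
     (\<forall>x v. v \<noteq> 0 \<longrightarrow> g x v v > 0) \<and>
     (\<forall>c\<in>A. \<forall>w1 w2. smooth_on (chart_range c)
        (\<lambda>u. g (chart_inv c u) (tangent_of A c (chart_inv c u) w1)
                               (tangent_of A c (chart_inv c u) w2)))"

definition riemannian_manifold ::
    "('m::{t2_space, second_countable_topology}, 'e::real_normed_vector) chart set \<Rightarrow>
     ('m \<Rightarrow> 'e \<Rightarrow> 'e \<Rightarrow> real) \<Rightarrow> bool" where
  "riemannian_manifold A g \<longleftrightarrow> smooth_manifold A \<and> riemannian_metric A g"

definition tnorm :: "('m \<Rightarrow> 'e \<Rightarrow> 'e \<Rightarrow> real) \<Rightarrow> 'm \<Rightarrow> 'e \<Rightarrow> real" where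
  "tnorm g x v = sqrt (g x v v)"

definition grad ::
    "('m, 'e::real_normed_vector) chart set \<Rightarrow> ('m \<Rightarrow> 'e \<Rightarrow> 'e \<Rightarrow> real) \<Rightarrow> ('m \<Rightarrow> real) \<Rightarrow> 'm \<Rightarrow> 'e" where
  "grad A g f x = (THE w. \<forall>v. g x w v = differential A f x v)"

text \<open>
  \<open>R x v\<close> is the value of the retraction at the tangent vector \<open>v\<close> of \<open>T\<^sub>xM\<close>.  Smoothness of
  \<open>R : TM \<rightarrow> M\<close> is expressed in the chart of \<open>TM\<close> induced by \<open>c\<close> and the chart \<open>d\<close>
  of \<open>M\<close>; requiring the preimages of chart domains to be open makes \<open>R\<close> continuous.
\<close>

definition smooth_on_TM ::
    "('m, 'e::real_normed_vector) chart set \<Rightarrow> ('m \<Rightarrow> 'e \<Rightarrow> 'm) \<Rightarrow> bool" where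
  "smooth_on_TM A R \<longleftrightarrow>
     (\<forall>c\<in>A. \<forall>d\<in>A.
        let F = (\<lambda>(u, w). R (chart_inv c u) (tangent_of A c (chart_inv c u) w));
            W = {(u, w). u \<in> chart_range c \<and> F (u, w) \<in> chart_dom d}
        in open W \<and> smooth_on W (chart_map d \<circ> F))"

text \<open>The derivative \<open>DR\<^sub>x(\<eta>)[\<xi>]\<close>, i.e. the differentiated retraction; it lies in the
  tangent space at \<open>R x \<eta>\<close>, hence the chart at that point.\<close>

definition D_retr ::
    "('m, 'e::real_normed_vector) chart set \<Rightarrow> ('m \<Rightarrow> 'e \<Rightarrow> 'm) \<Rightarrow> 'm \<Rightarrow> 'e \<Rightarrow> 'e \<Rightarrow> 'e" where
  "D_retr A R x \<eta> \<xi> = frechet_derivative (chart_map (chart_at A (R x \<eta>)) \<circ> R x) (at \<eta>) \<xi>"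

definition retraction_on_manifold ::
    "('m, 'e::real_normed_vector) chart set \<Rightarrow> ('m \<Rightarrow> 'e \<Rightarrow> 'm) \<Rightarrow> bool" where
  "retraction_on_manifold A R \<longleftrightarrow>
     smooth_on_TM A R \<and> (\<forall>x. R x 0 = x) \<and> (\<forall>x \<xi>. D_retr A R x 0 \<xi> = \<xi>)"

definition scaled_transport ::
    "('m, 'e::real_normed_vector) chart set \<Rightarrow> ('m \<Rightarrow> 'e \<Rightarrow> 'e \<Rightarrow> real) \<Rightarrow> ('m \<Rightarrow> 'e \<Rightarrow> 'm) \<Rightarrow>
     'm \<Rightarrow> 'e \<Rightarrow> 'e \<Rightarrow> 'e" where
  "scaled_transport A g R x \<eta> \<xi> =
     (tnorm g x \<xi> / tnorm g (R x \<eta>) (D_retr A R x \<eta> \<xi>)) *\<^sub>R D_retr A R x \<eta> \<xi>"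

definition weak_wolfe ::
    "('m, 'e::real_normed_vector) chart set \<Rightarrow> ('m \<Rightarrow> 'e \<Rightarrow> 'e \<Rightarrow> real) \<Rightarrow> ('m \<Rightarrow> 'e \<Rightarrow> 'm) \<Rightarrow>
     ('m \<Rightarrow> real) \<Rightarrow> real \<Rightarrow> real \<Rightarrow> 'm \<Rightarrow> 'e \<Rightarrow> real \<Rightarrow> bool" where
  "weak_wolfe A g R f c1 c2 x \<eta> \<alpha> \<longleftrightarrow>
     f (R x (\<alpha> *\<^sub>R \<eta>)) \<le> f x + c1 * \<alpha> * g x (grad A g f x) \<eta> \<and>
     g (R x (\<alpha> *\<^sub>R \<eta>)) (grad A g f (R x (\<alpha> *\<^sub>R \<eta>))) (D_retr A R x (\<alpha> *\<^sub>R \<eta>) \<eta>)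
       \<ge> c2 * g x (grad A g f x) \<eta>"

definition DY_transport ::
    "('m, 'e::real_normed_vector) chart set \<Rightarrow> ('m \<Rightarrow> 'e \<Rightarrow> 'e \<Rightarrow> real) \<Rightarrow> ('m \<Rightarrow> 'e \<Rightarrow> 'm) \<Rightarrow>
     'm \<Rightarrow> real \<Rightarrow> 'e \<Rightarrow> 'e" where
  "DY_transport A g R x \<alpha> \<eta> =
     (if tnorm g (R x (\<alpha> *\<^sub>R \<eta>)) (D_retr A R x (\<alpha> *\<^sub>R \<eta>) \<eta>) \<le> tnorm g x \<eta>
      then D_retr A R x (\<alpha> *\<^sub>R \<eta>) \<eta>
      else scaled_transport A g R x (\<alpha> *\<^sub>R \<eta>) \<eta>)"

definition scaled_DY_sequence ::
    "('m, 'e::real_normed_vector) chart set \<Rightarrow> ('m \<Rightarrow> 'e \<Rightarrow> 'e \<Rightarrow> real) \<Rightarrow> ('m \<Rightarrow> 'e \<Rightarrow> 'm) \<Rightarrow>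
     ('m \<Rightarrow> real) \<Rightarrow> real \<Rightarrow> real \<Rightarrow>
     (nat \<Rightarrow> 'm) \<Rightarrow> (nat \<Rightarrow> 'e) \<Rightarrow> (nat \<Rightarrow> real) \<Rightarrow> (nat \<Rightarrow> real) \<Rightarrow> bool" where
  "scaled_DY_sequence A g R f c1 c2 x \<eta> \<alpha> \<beta> \<longleftrightarrow>
     \<eta> 0 = - grad A g f (x 0) \<and>
     (\<forall>k. \<alpha> k > 0 \<and> weak_wolfe A g R f c1 c2 (x k) (\<eta> k) (\<alpha> k) \<and>
          x (Suc k) = R (x k) (\<alpha> k *\<^sub>R \<eta> k) \<and>
          \<beta> (Suc k) =
            (if grad A g f (x (Suc k)) = 0 then 0
             else (tnorm g (x (Suc k)) (grad A g f (x (Suc k))))\<^sup>2 /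
                  (g (x (Suc k)) (grad A g f (x (Suc k))) (DY_transport A g R (x k) (\<alpha> k) (\<eta> k))
                   - g (x k) (grad A g f (x k)) (\<eta> k))) \<and>
          \<eta> (Suc k) = - grad A g f (x (Suc k)) +
                       \<beta> (Suc k) *\<^sub>R DY_transport A g R (x k) (\<alpha> k) (\<eta> k))"

end

theory Submission
  imports Defs
begin

text \<open>
  Write \<open>h\<close> for the gradient norm and \<open>D\<close> for the inner product of gradient and search
  direction \<open>\<eta>\<close>.  The transport is a multiple of the differentiated retraction by a factor in
  \<open>[0, 1]\<close>, so the curvature condition keeps \<open>D\<close> negative and the definition of \<open>\<beta>\<close> becomes
  \<open>\<beta>\<^sub>k\<^sub>+\<^sub>1 = D\<^sub>k\<^sub>+\<^sub>1 / D\<^sub>k\<close>.  As the transport does not increase norms, expanding the square of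
  \<open>\<eta>\<^sub>k\<^sub>+\<^sub>1 + grad f(x\<^sub>k\<^sub>+\<^sub>1)\<close> shows that \<open>a\<^sub>k = \<parallel>\<eta>\<^sub>k\<parallel>\<^sup>2 / D\<^sub>k\<^sup>2\<close> increases by at most
  \<open>1 / h\<^sub>k\<^sub>+\<^sub>1\<^sup>2\<close> per step.  The Wolfe conditions and the Lipschitz condition make \<open>f\<close> decrease by
  a fixed multiple of \<open>1 / a\<^sub>k\<close>, hence the series of the \<open>1 / a\<^sub>k\<close> converges (Zoutendijk), which
  is impossible if \<open>h\<close> is bounded away from \<open>0\<close>.
\<close>

section \<open>Riesz representation and the Riemannian gradient\<close>

text \<open>Gram-Schmidt, one spanning vector at a time: the representative on the smaller span is
  corrected by a multiple of the part of the new vector that is orthogonal to that span.\<close>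

lemma riesz_span:
  fixes b :: "'e::real_vector \<Rightarrow> 'e \<Rightarrow> real"
  assumes "finite B" and bil: "bilinear b" and sym: "\<And>v w. b v w = b w v"
    and pos: "\<And>v. v \<noteq> 0 \<Longrightarrow> b v v > 0" and "linear l"
  shows "\<exists>w\<in>span B. \<forall>v\<in>span B. b w v = l v"
  using \<open>finite B\<close> \<open>linear l\<close>
proof (induction B arbitrary: l rule: finite_induct)
  case empty
  then show ?case
    using bil by (auto simp: bilinear_lzero linear_0)
next
  case (insert y B)
  have lin: "linear (b w)" for w
    using bil by (simp add: bilinear_def)
  have subset: "span B \<subseteq> span (insert y B)"
    by (simp add: span_mono subset_insertI)
  obtain w0 where w0: "w0 \<in> span B" "\<And>v. v \<in> span B \<Longrightarrow> b w0 v = l v"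
    using insert.IH[OF \<open>linear l\<close>] by blast
  \<comment> \<open>\<open>p\<close> is the orthogonal projection of \<open>y\<close> to
    \<open>span B\<close>, obtained as the representative of the functional \<open>b y\<close>; the
    induction is therefore over all \<open>l\<close>.\<close>
  obtain p where p: "p \<in> span B" "\<And>v. v \<in> span B \<Longrightarrow> b p v = b y v"
    using insert.IH[OF lin[of y]] by blast
  define u where "u = y - p"
  have orth: "b u v = 0" if "v \<in> span B" for v
    using p(2)[OF that] by (simp add: u_def bilinear_lsub[OF bil])
  define w where "w = w0 + ((l u) / b u u) *\<^sub>R u"
  have "w \<in> span (insert y B)"
    unfolding w_def u_def using subset w0(1) p(1)
    by (intro span_add span_scale span_diff) (auto intro: span_base)
  moreover have "b w v = l v" if v_span: "v \<in> span (insert y B)" for v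
  proof -
    obtain k where "v - k *\<^sub>R y \<in> span B"
      using v_span span_breakdown_eq[of v y B] by blast
    then have "(v - k *\<^sub>R y) + k *\<^sub>R p \<in> span B"
      using p(1) by (intro span_add span_scale)
    then have "v - k *\<^sub>R u \<in> span B"
      by (simp add: u_def algebra_simps)
    then obtain q where v: "v = q + k *\<^sub>R u" and qs: "q \<in> span B"
      by (metis diff_add_cancel)
    \<comment> \<open>If \<open>y\<close> already lies in \<open>span B\<close>, then
      \<open>u\<close> may be 0; the quotient is then 0, which agrees with
      \<open>l 0 = 0\<close>.\<close>
    have "l u / b u u * b u u = l u"
      using pos[of u] insert.prems by (cases "u = 0") (auto simp: linear_0)
    moreover have "b w0 u = 0"
      using orth[OF w0(1)] sym by simp
    ultimately show ?thesis
      unfolding v w_def using w0(2)[OF qs] orth[OF qs] insert.prems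
      by (simp add: bilinear_ladd[OF bil] bilinear_radd[OF bil] bilinear_lmul[OF bil]
          bilinear_rmul[OF bil] linear_add linear_cmul algebra_simps)
  qed
  ultimately show ?case by blast
qed

lemma chart_at_props:
  assumes "smooth_manifold A"
  shows "chart_at A x \<in> A" "x \<in> chart_dom (chart_at A x)" "is_chart (chart_at A x)"
proof -
  have "\<exists>c. c \<in> A \<and> x \<in> chart_dom c"
    using assms unfolding smooth_manifold_def by blast
  then have "chart_at A x \<in> A \<and> x \<in> chart_dom (chart_at A x)"
    unfolding chart_at_def by (rule someI_ex)
  then show "chart_at A x \<in> A" "x \<in> chart_dom (chart_at A x)" "is_chart (chart_at A x)"
    using assms by (auto simp: smooth_manifold_def)
qed

lemma is_chart_inverse:
  assumes "is_chart c"
  shows "y \<in> chart_dom c \<Longrightarrow> chart_inv c (chart_map c y) = y"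
    and "u \<in> chart_range c \<Longrightarrow> chart_map c (chart_inv c u) = u"
    and "y \<in> chart_dom c \<Longrightarrow> chart_map c y \<in> chart_range c"
  using assms by (auto simp: is_chart_def homeomorphism_def chart_range_def)

lemma chart_function_has_derivative:
  assumes "smooth_manifold A" "C1_function A f"
  shows "(f \<circ> chart_inv (chart_at A x) has_derivative differential A f x)
    (at (chart_map (chart_at A x) x))"
proof -
  have "f \<circ> chart_inv (chart_at A x) differentiable (at (chart_map (chart_at A x) x))"
    using assms(2) chart_at_props[OF assms(1), of x]
    by (auto simp: C1_function_def is_chart_inverse(3))
  then show ?thesis
    unfolding differential_def by (simp add: frechet_derivative_works)
qed

text \<open>As \<open>grad\<close> is a definite description, both existence (Riesz on a finite
  spanning set of the model space) and uniqueness (definiteness of the metric) are needed to unfold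
  it.\<close>

lemma inner_grad:
  assumes "riemannian_manifold A g" "C1_function A f"
  shows "g x (grad A g f x) v = differential A f x v"
proof -
  have man: "smooth_manifold A" and met: "riemannian_metric A g"
    using assms(1) by (auto simp: riemannian_manifold_def)
  obtain B :: "'b set" where B: "finite B" "span B = UNIV"
    using man by (auto simp: smooth_manifold_def)
  have bil: "bilinear (g x)" and sym: "\<And>v w. g x v w = g x w v"
    and pos: "\<And>v. v \<noteq> 0 \<Longrightarrow> g x v v > 0"
    using met by (auto simp: riemannian_metric_def)
  have "linear (differential A f x)"
    using chart_function_has_derivative[OF man assms(2)] has_derivative_linear by blast
  from riesz_span[OF B(1) bil sym pos this]
  obtain w where w: "\<forall>v. g x w v = differential A f x v"
    using B(2) by auto
  have "\<exists>!w. \<forall>v. g x w v = differential A f x v"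
  proof (rule ex1I, rule w)
    fix w' assume "\<forall>v. g x w' v = differential A f x v"
    then have "g x (w' - w) (w' - w) = 0"
      using w by (simp add: bilinear_lsub[OF bil])
    then show "w' = w"
      using pos[of "w' - w"] by force
  qed
  then have "\<forall>v. g x (grad A g f x) v = differential A f x v"
    unfolding grad_def by (rule theI')
  then show ?thesis by blast
qed

section \<open>The retraction in charts and the chain rule\<close>

lemma tangent_of_chart_at:
  assumes "smooth_manifold A"
  shows "tangent_of A (chart_at A x) x w = w"
proof -
  let ?c = "chart_at A x"
  have op: "open (chart_range ?c)"
    using chart_at_props(3)[OF assms] by (auto simp: is_chart_def)
  have "(chart_map ?c \<circ> chart_inv ?c has_derivative (\<lambda>w. w)) (at (chart_map ?c x))"
  proof (rule has_derivative_transform_within_open[OF has_derivative_ident op])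
    show "chart_map ?c x \<in> chart_range ?c"
      using chart_at_props[OF assms] by (simp add: is_chart_inverse(3))
  qed (use is_chart_inverse(2)[OF chart_at_props(3)[OF assms]] in simp)
  then show ?thesis
    unfolding tangent_of_def by (simp add: frechet_derivative_at[symmetric])
qed

lemma smooth_on_imp_differentiable:
  "smooth_on S f \<Longrightarrow> x \<in> S \<Longrightarrow> f differentiable (at x)"
  unfolding smooth_on_def by (metis higher_differentiable_on.simps(2))

text \<open>Smoothness on the tangent bundle is restricted to the fibre over \<open>p\<close>. In
  the bundle chart induced by \<open>chart_at A p\<close> this fibre is a slice with constant first
  coordinate, on which the chart acts as the identity.\<close>

lemma retraction_in_chart:
  fixes A :: "('m::{t2_space, second_countable_topology}, 'e::real_normed_vector) chart set"
  assumes "smooth_manifold A" "smooth_on_TM A R" "d \<in> A" "R p v \<in> chart_dom d"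
  shows "open {w. R p w \<in> chart_dom d}"
    and "(chart_map d \<circ> R p) differentiable (at v)"
proof -
  define c where "c = chart_at A p"
  define u where "u = chart_map c p"
  define F where "F = (\<lambda>(u, w). R (chart_inv c u) (tangent_of A c (chart_inv c u) w))"
  define W where "W = {(u, w). u \<in> chart_range c \<and> F (u, w) \<in> chart_dom d}"
  have c: "c \<in> A" "p \<in> chart_dom c" "is_chart c"
    using chart_at_props[OF assms(1)] by (auto simp: c_def)
  have W: "open W" "smooth_on W (chart_map d \<circ> F)"
    using assms(2,3) c(1) unfolding smooth_on_TM_def W_def F_def by (metis (no_types, lifting))+
  have u: "u \<in> chart_range c" "chart_inv c u = p"
    using is_chart_inverse[OF c(3)] c(2) by (auto simp: u_def)
  have F: "F (u, w) = R p w" for w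
    using tangent_of_chart_at[OF assms(1), of p w, folded c_def] by (simp add: F_def u)
  have "{w. R p w \<in> chart_dom d} = (\<lambda>w. (u, w)) -` W"
    by (auto simp: W_def u F)
  moreover have "open ((\<lambda>w. (u, w)) -` W)"
    by (intro open_vimage W continuous_intros)
  ultimately show "open {w. R p w \<in> chart_dom d}"
    by simp
  have "(u, v) \<in> W"
    using assms(4) by (simp add: W_def u F)
  with W(2) have "(chart_map d \<circ> F) differentiable (at (u, v))"
    by (rule smooth_on_imp_differentiable)
  moreover have "(\<lambda>w. (u, w)) differentiable (at v)"
    unfolding differentiable_def by (rule exI) (rule derivative_intros)+
  ultimately have "(chart_map d \<circ> F) \<circ> (\<lambda>w. (u, w)) differentiable (at v)"
    by (intro differentiable_chain_at)
  moreover have "(chart_map d \<circ> F) \<circ> (\<lambda>w. (u, w)) = chart_map d \<circ> R p"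
    by (simp add: fun_eq_iff F)
  ultimately show "(chart_map d \<circ> R p) differentiable (at v)"
    by simp
qed

text \<open>The chain rule through a chart around \<open>R p v\<close>. It connects the derivative
  in the Lipschitz condition with the inner product in the curvature condition.\<close>

lemma compose_retraction_has_derivative:
  fixes A :: "('m::{t2_space, second_countable_topology}, 'e::real_normed_vector) chart set"
  assumes "riemannian_manifold A g" "smooth_on_TM A R" "C1_function A f"
  shows "(f \<circ> R p has_derivative (\<lambda>w. g (R p v) (grad A g f (R p v)) (D_retr A R p v w))) (at v)"
proof -
  have man: "smooth_manifold A"
    using assms(1) by (simp add: riemannian_manifold_def)
  define c where "c = chart_at A (R p v)"
  have c: "c \<in> A" "R p v \<in> chart_dom c" "is_chart c"
    using chart_at_props[OF man] by (auto simp: c_def)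
  note in_chart = retraction_in_chart[of A R c p v, OF man assms(2) c(1,2)]
  have "(chart_map c \<circ> R p has_derivative D_retr A R p v) (at v)"
    using in_chart(2) unfolding D_retr_def c_def[symmetric] by (simp add: frechet_derivative_works)
  moreover have "(f \<circ> chart_inv c has_derivative differential A f (R p v))
      (at ((chart_map c \<circ> R p) v))"
    using chart_function_has_derivative[OF man assms(3), of "R p v"] by (simp add: c_def)
  ultimately have "((f \<circ> chart_inv c) \<circ> (chart_map c \<circ> R p) has_derivative
      differential A f (R p v) \<circ> D_retr A R p v) (at v)"
    by (rule diff_chain_at)
  \<comment> \<open>The chart and its inverse cancel only where \<open>R p\<close> stays in the
    chart domain, which is an open neighbourhood of \<open>v\<close>.\<close>
  then have "(f \<circ> R p has_derivative differential A f (R p v) \<circ> D_retr A R p v) (at v)"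
    by (rule has_derivative_transform_within_open[OF _ in_chart(1)])
      (use c in \<open>auto simp: is_chart_inverse(1)\<close>)
  then show ?thesis
    by (simp add: o_def inner_grad[OF assms(1,3)])
qed

section \<open>The Zoutendijk argument for real sequences\<close>

text \<open>If \<open>h\<close> stays above some \<gamma> > 0, then \<open>a\<close> grows at most
  linearly, so the decrements \<open>c / a k\<close> dominate a multiple of the harmonic series;
  boundedness of \<open>F\<close> from below makes their sum finite.\<close>

lemma liminf_zero_of_decrease:
  fixes F a h :: "nat \<Rightarrow> real"
  assumes "c > 0" and bdd: "\<And>k. m \<le> F k" and dec: "\<And>k. F (Suc k) \<le> F k - c / a k"
    and apos: "\<And>k. a k > 0" and h0: "\<And>k. h k \<ge> 0"
    and grow: "\<And>k. a (Suc k) \<le> a k + 1 / (h (Suc k))\<^sup>2"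
  shows "liminf (\<lambda>k. ereal (h k)) = 0"
proof (rule ccontr)
  assume ne: "liminf (\<lambda>k. ereal (h k)) \<noteq> 0"
  have "0 \<le> liminf (\<lambda>k. ereal (h k))"
    by (intro Liminf_bounded) (simp add: h0)
  with ne have "0 < liminf (\<lambda>k. ereal (h k))" by simp
  then obtain \<gamma> where gap: "0 < ereal \<gamma>" "ereal \<gamma> < liminf (\<lambda>k. ereal (h k))"
    using ereal_dense2 by blast
  have \<gamma>: "\<gamma> > 0" "\<forall>\<^sub>F k in sequentially. h k > \<gamma>"
    using gap(1) less_LiminfD[OF gap(2)] by simp_all
  then obtain K where K: "\<And>k. k \<ge> K \<Longrightarrow> h k > \<gamma>"
    by (auto simp: eventually_sequentially)
  \<comment> \<open>\<open>C\<close> bounds both the value at \<open>K\<close> and every later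
    increment, which gives the linear bound \<open>C * (n + 1)\<close>.\<close>
  define C where "C = max (a K) (1 / \<gamma>\<^sup>2)"
  have C: "C > 0" "a K \<le> C" "1 / \<gamma>\<^sup>2 \<le> C"
    using apos[of K] by (auto simp: C_def)
  have a_le: "a (K + n) \<le> C * real (Suc n)" for n
  proof (induction n)
    case (Suc n)
    have "1 / (h (Suc (K + n)))\<^sup>2 \<le> 1 / \<gamma>\<^sup>2"
      using K[of "Suc (K + n)"] \<gamma>(1) by (intro divide_left_mono power_mono) auto
    then show ?case
      using grow[of "K + n"] Suc C by (simp add: algebra_simps)
  qed (use C in simp)
  have "(\<Sum>k<n. c / a k) \<le> F 0 - F n" for n
  proof (induction n)
    case (Suc n)
    then show ?case using dec[of n] by simp
  qed simp
  then have "(\<Sum>k<n. c / a k) \<le> F 0 - m" for n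
    using bdd[of n] by (smt (verit))
  then have "summable (\<lambda>k. c / a k)"
    using apos \<open>c > 0\<close> by (intro summableI_nonneg_bounded) (auto intro: less_imp_le)
  then have "summable (\<lambda>n. c / a (K + n))"
    using summable_ignore_initial_segment[of "\<lambda>k. c / a k" K] by (simp add: add.commute)
  moreover have "norm ((c / C) * (1 / real (Suc n))) \<le> c / a (K + n)" for n
    using a_le[of n] apos[of "K + n"] \<open>c > 0\<close> C(1) by (simp add: frac_le)
  ultimately have "summable (\<lambda>n. (c / C) * (1 / real (Suc n)))"
    by (rule summable_comparison_test'[where N = 0])
  then have "summable (\<lambda>n. 1 / real (Suc n))"
    using \<open>c > 0\<close> C(1) by (subst (asm) summable_cmult_iff) auto
  then have "summable (\<lambda>n. 1 / real n)"
    using summable_Suc_iff[of "\<lambda>n. 1 / real n"] by blast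
  then show False
    using not_summable_harmonic[where 'a = real] by (simp add: inverse_eq_divide)
qed

section \<open>Norms and the scaled transport\<close>

lemma tnorm_facts:
  assumes "riemannian_metric A g"
  shows "(tnorm g p v)\<^sup>2 = g p v v" "tnorm g p v \<ge> 0" "tnorm g p v = 0 \<longleftrightarrow> v = 0"
    "tnorm g p (t *\<^sub>R v) = \<bar>t\<bar> * tnorm g p v"
proof -
  have bil: "bilinear (g p)" and pos: "\<And>v. v \<noteq> 0 \<Longrightarrow> g p v v > 0"
    using assms by (auto simp: riemannian_metric_def)
  have nonneg: "g p v v \<ge> 0"
    using pos[of v] by (cases "v = 0") (auto simp: bilinear_lzero[OF bil])
  then show "(tnorm g p v)\<^sup>2 = g p v v" "tnorm g p v \<ge> 0"
    by (auto simp: tnorm_def)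
  show "tnorm g p v = 0 \<longleftrightarrow> v = 0"
    using pos[of v] by (cases "v = 0") (auto simp: tnorm_def bilinear_lzero[OF bil])
  show "tnorm g p (t *\<^sub>R v) = \<bar>t\<bar> * tnorm g p v"
    using nonneg
    by (simp add: tnorm_def bilinear_lmul[OF bil] bilinear_rmul[OF bil] real_sqrt_mult
        flip: mult.assoc power2_eq_square)
qed

lemma DY_transport_shrinks:
  assumes "riemannian_metric A g"
  shows "tnorm g (R p (t *\<^sub>R v)) (DY_transport A g R p t v) \<le> tnorm g p v"
    and "\<exists>s. 0 \<le> s \<and> s \<le> 1 \<and> DY_transport A g R p t v = s *\<^sub>R D_retr A R p (t *\<^sub>R v) v"
proof -
  define w where "w = D_retr A R p (t *\<^sub>R v) v"
  define q where "q = R p (t *\<^sub>R v)"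
  \<comment> \<open>In the second branch \<open>tnorm g q w\<close> exceeds a nonnegative number, so
    the division is genuine and the ratio is below 1.\<close>
  define s where "s = (if tnorm g q w \<le> tnorm g p v then 1 else tnorm g p v / tnorm g q w)"
  have eq: "DY_transport A g R p t v = s *\<^sub>R w"
    by (simp add: DY_transport_def scaled_transport_def s_def w_def q_def)
  have n: "tnorm g q w \<ge> 0" "tnorm g p v \<ge> 0"
    using tnorm_facts(2)[OF assms] by auto
  have s: "0 \<le> s" "s \<le> 1" "s * tnorm g q w \<le> tnorm g p v"
    using n by (auto simp: s_def divide_simps)
  then show "\<exists>s. 0 \<le> s \<and> s \<le> 1 \<and> DY_transport A g R p t v = s *\<^sub>R D_retr A R p (t *\<^sub>R v) v"
    using eq by (auto simp: w_def)
  show "tnorm g (R p (t *\<^sub>R v)) (DY_transport A g R p t v) \<le> tnorm g p v"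
    using s unfolding eq q_def[symmetric] by (simp add: tnorm_facts(4)[OF assms])
qed

section \<open>Estimates for a single iteration\<close>

text \<open>\<open>N\<close> and \<open>N'\<close> are the squared norms of successive directions,
  \<open>D\<close> and \<open>D'\<close> their inner products with the gradients, \<open>H\<close>
  the new squared gradient norm and \<open>b\<close> the parameter \<beta>.\<close>

lemma DY_ratio_bound:
  fixes D D' N N' H b :: real
  assumes "D < 0" "H > 0" "b > 0" "D' = b * D" "N' \<le> b\<^sup>2 * N - 2 * D' - H"
  shows "N' / D'\<^sup>2 \<le> N / D\<^sup>2 + 1 / H"
proof -
  have D': "D' < 0"
    using assms by (simp add: mult_pos_neg)
  have "N' / D'\<^sup>2 \<le> (b\<^sup>2 * N - 2 * D' - H) / D'\<^sup>2"
    using assms(5) by (intro divide_right_mono) auto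
  also have "\<dots> = N / D\<^sup>2 - (2 * D' + H) / D'\<^sup>2"
    using assms(1,3) by (simp add: assms(4) field_simps power2_eq_square)
  also have "\<dots> \<le> N / D\<^sup>2 + 1 / H"
  proof -
    \<comment> \<open>Completing the square: the slack in the bound is a nonnegative
      quotient.\<close>
    have "1 / H + (2 * D' + H) / D'\<^sup>2 = (D' + H)\<^sup>2 / (H * D'\<^sup>2)"
      using D' assms(2) by (simp add: field_simps power2_eq_square)
    also have "\<dots> \<ge> 0"
      using assms(2) by simp
    finally show ?thesis by simp
  qed
  finally show ?thesis .
qed

text \<open>The curvature condition forces the slope along \<eta> to rise by at least
  \<open>(1 - c2) * (- D)\<close>, while the Lipschitz condition limits its rise to
  \<open>L * \<alpha> * n\<^sup>2\<close>. This bounds \<alpha> from below, and the sufficient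
  decrease condition turns the bound into a drop of \<open>f\<close>.\<close>

lemma weak_wolfe_decrease:
  fixes A :: "('m::{t2_space, second_countable_topology}, 'e::real_normed_vector) chart set"
  assumes man: "riemannian_manifold A g" and ret: "retraction_on_manifold A R"
    and C1: "C1_function A f" and "L > 0"
    and lip: "\<And>v t. tnorm g p v = 1 \<Longrightarrow> t \<ge> 0 \<Longrightarrow>
           \<bar>frechet_derivative (f \<circ> R p) (at (t *\<^sub>R v)) v - frechet_derivative (f \<circ> R p) (at 0) v\<bar> \<le> L * t"
    and "0 < c1" and "\<alpha> > 0" and wolfe: "weak_wolfe A g R f c1 c2 p \<eta> \<alpha>"
    and descent: "g p (grad A g f p) \<eta> < 0"
  shows "f (R p (\<alpha> *\<^sub>R \<eta>)) \<le>
    f p - c1 * (1 - c2) / L / (g p \<eta> \<eta> / (g p (grad A g f p) \<eta>)\<^sup>2)"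
proof -
  have met: "riemannian_metric A g" and TM: "smooth_on_TM A R"
    and R0: "R p 0 = p" "\<And>\<xi>. D_retr A R p 0 \<xi> = \<xi>"
    using man ret by (auto simp: riemannian_manifold_def retraction_on_manifold_def)
  define D where "D = g p (grad A g f p) \<eta>"
  define n where "n = tnorm g p \<eta>"
  have "\<eta> \<noteq> 0"
    using descent bilinear_rzero[of "g p" "grad A g f p"] met by (auto simp: riemannian_metric_def)
  then have n: "n > 0"
    using tnorm_facts(2,3)[OF met, of p \<eta>] by (auto simp: n_def less_le)
  have n2: "g p \<eta> \<eta> = n\<^sup>2"
    using tnorm_facts(1)[OF met] by (simp add: n_def)
  \<comment> \<open>The Lipschitz condition speaks of unit vectors only. Normalising gives one
    factor \<open>n\<close> in the parameter \<open>\<alpha> * n\<close> and another by linearity of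
    the derivative.\<close>
  define v where "v = (1 / n) *\<^sub>R \<eta>"
  have v: "tnorm g p v = 1" "\<alpha> *\<^sub>R \<eta> = (\<alpha> * n) *\<^sub>R v" "\<eta> = n *\<^sub>R v"
    using n tnorm_facts(4)[OF met] by (auto simp: v_def n_def)
  have deriv: "frechet_derivative (f \<circ> R p) (at w) =
      (\<lambda>\<xi>. g (R p w) (grad A g f (R p w)) (D_retr A R p w \<xi>))" for w
    using frechet_derivative_at[OF compose_retraction_has_derivative[OF man TM C1]] by simp
  have lin: "linear (frechet_derivative (f \<circ> R p) (at w))" for w
    unfolding deriv
    using has_derivative_linear[OF compose_retraction_has_derivative[OF man TM C1]] .
  define y where "y = \<alpha> *\<^sub>R \<eta>"
  let ?d = "\<lambda>w. frechet_derivative (f \<circ> R p) (at w)"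
  have "c2 * D \<le> ?d y \<eta>"
    using wolfe by (simp add: weak_wolfe_def deriv y_def D_def)
  moreover have D0: "D = ?d 0 \<eta>"
    by (simp add: deriv R0 D_def)
  ultimately have "- ((1 - c2) * D) \<le> ?d y \<eta> - ?d 0 \<eta>"
    by (simp add: algebra_simps)
  also have "\<dots> = n * (?d y v - ?d 0 v)"
    using linear_cmul[OF lin, of _ n v] by (simp add: v(3)[symmetric] algebra_simps)
  also have "\<dots> \<le> n * (L * (\<alpha> * n))"
    using lip[OF v(1), of "\<alpha> * n"] n \<open>\<alpha> > 0\<close> by (simp add: y_def v(2))
  finally have "- ((1 - c2) * D) / (L * n\<^sup>2) \<le> \<alpha>"
    using n \<open>L > 0\<close> by (subst pos_divide_le_eq) (auto simp: power2_eq_square mult_ac)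
  then have "c1 * (- D) * (- ((1 - c2) * D) / (L * n\<^sup>2)) \<le> c1 * (- D) * \<alpha>"
    using \<open>0 < c1\<close> descent by (intro mult_left_mono) (auto simp: D_def mult_nonneg_nonpos)
  moreover have "c1 * (- D) * (- ((1 - c2) * D) / (L * n\<^sup>2)) = c1 * (1 - c2) / L / (n\<^sup>2 / D\<^sup>2)"
    by (simp add: power2_eq_square)
  moreover have "f (R p (\<alpha> *\<^sub>R \<eta>)) \<le> f p + c1 * \<alpha> * D"
    using wolfe by (simp add: weak_wolfe_def D_def)
  ultimately show ?thesis
    unfolding n2 D_def[symmetric] by (simp only: mult_ac mult_minus_left mult_minus_right)
qed

text \<open>From \<open>p\<close> to \<open>q\<close>, the descent property is inherited and the
  ratio of squared norm to squared slope grows in a controlled way. Everything rests on the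
  denominator of \<open>b\<close> being positive.\<close>

lemma DY_step:
  fixes A :: "('m::{t2_space, second_countable_topology}, 'e::real_normed_vector) chart set"
  assumes met: "riemannian_metric A g" and "c2 > 0" and "c2 < 1"
    and wolfe: "weak_wolfe A g R f c1 c2 p \<eta> \<alpha>"
    and descent: "g p (grad A g f p) \<eta> < 0"
    and q: "q = R p (\<alpha> *\<^sub>R \<eta>)" and nz: "grad A g f q \<noteq> 0"
    and T: "T = DY_transport A g R p \<alpha> \<eta>"
    and b: "b = (tnorm g q (grad A g f q))\<^sup>2 / (g q (grad A g f q) T - g p (grad A g f p) \<eta>)"
    and \<eta>': "\<eta>' = - grad A g f q + b *\<^sub>R T"
  shows "g q (grad A g f q) \<eta>' < 0"
    and "g q \<eta>' \<eta>' / (g q (grad A g f q) \<eta>')\<^sup>2 \<le>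
      g p \<eta> \<eta> / (g p (grad A g f p) \<eta>)\<^sup>2 + 1 / (tnorm g q (grad A g f q))\<^sup>2"
proof -
  have bil: "bilinear (g q)" and sym: "\<And>v w. g q v w = g q w v"
    using met by (auto simp: riemannian_metric_def)
  define G where "G = grad A g f q"
  define D where "D = g p (grad A g f p) \<eta>"
  define H where "H = (tnorm g q G)\<^sup>2"
  define t where "t = g q G T"
  have H: "H > 0" "g q G G = H"
    using tnorm_facts(3)[OF met, of q G] nz
    by (simp_all add: H_def G_def flip: tnorm_facts(1)[OF met])
  obtain s where s: "0 \<le> s" "s \<le> 1" "T = s *\<^sub>R D_retr A R p (\<alpha> *\<^sub>R \<eta>) \<eta>"
    using DY_transport_shrinks(2)[OF met, of R p \<alpha> \<eta>] T by auto
  \<comment> \<open>A negative number increases when multiplied by \<open>c2\<close> in (0, 1) and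
    does not decrease when multiplied by \<open>s\<close> in [0, 1]; so shrinking the transported
    vector preserves the use of the curvature condition.\<close>
  have "D < c2 * D"
    using \<open>c2 < 1\<close> descent by (simp add: D_def)
  also have "\<dots> \<le> s * (c2 * D)"
    using s(1,2) \<open>c2 > 0\<close> descent
    by (simp add: D_def mult_le_cancel_right2 mult_pos_neg less_imp_le)
  also have "\<dots> \<le> s * g q G (D_retr A R p (\<alpha> *\<^sub>R \<eta>) \<eta>)"
    using wolfe s(1) unfolding weak_wolfe_def q G_def D_def by (intro mult_left_mono) auto
  also have "\<dots> = t"
    by (simp add: t_def s(3) bilinear_rmul[OF bil])
  finally have denom: "t - D > 0" by simp
  have b: "b = H / (t - D)"
    using b by (simp add: H_def t_def D_def G_def)
  with H denom have "b > 0" by simp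
  \<comment> \<open>The Dai-Yuan identity: \<open>H = b * (t - D)\<close> turns
    \<open>b * t - H\<close> into \<open>b * D\<close>.\<close>
  have D': "g q G \<eta>' = b * D"
  proof -
    have "g q G \<eta>' = b * t - H"
      unfolding \<eta>' G_def[symmetric]
      by (simp add: bilinear_radd[OF bil] bilinear_rmul[OF bil] bilinear_rneg[OF bil] H t_def
          bilinear_rsub[OF bil])
    also have "\<dots> = b * D"
      using denom by (simp add: b field_simps)
    finally show ?thesis .
  qed
  have "D < 0" using descent by (simp add: D_def)
  with D' \<open>b > 0\<close> show "g q (grad A g f q) \<eta>' < 0"
    by (simp add: G_def mult_pos_neg)
  have "tnorm g q T \<le> tnorm g p \<eta>"
    using DY_transport_shrinks(1)[OF met] by (simp add: q T)
  then have "g q T T \<le> g p \<eta> \<eta>"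
    unfolding tnorm_facts(1)[OF met, symmetric] using tnorm_facts(2)[OF met] by (rule power_mono)
  \<comment> \<open>This expands the squared norm of
    \<open>\<eta>' + G = b *\<^sub>R T\<close>.\<close>
  moreover have "g q \<eta>' \<eta>' = b\<^sup>2 * g q T T - 2 * g q G \<eta>' - H"
    unfolding \<eta>' G_def[symmetric] using sym[of T G] H(2)
    by (simp add: bilinear_ladd[OF bil] bilinear_radd[OF bil] bilinear_lmul[OF bil]
        bilinear_rmul[OF bil] bilinear_lneg[OF bil] bilinear_rneg[OF bil]
        bilinear_lsub[OF bil] bilinear_rsub[OF bil]
        power2_eq_square algebra_simps)
  ultimately have "g q \<eta>' \<eta>' \<le> b\<^sup>2 * g p \<eta> \<eta> - 2 * g q G \<eta>' - H"
    by (simp add: mult_left_mono)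
  from DY_ratio_bound[OF \<open>D < 0\<close> H(1) \<open>b > 0\<close> D' this]
  show "g q \<eta>' \<eta>' / (g q (grad A g f q) \<eta>')\<^sup>2 \<le>
      g p \<eta> \<eta> / (g p (grad A g f p) \<eta>)\<^sup>2 + 1 / (tnorm g q (grad A g f q))\<^sup>2"
    by (simp add: G_def D_def H_def)
qed

section \<open>Convergence of the scaled Dai-Yuan method\<close>

theorem theorem4p2:
  fixes A :: "('m::{t2_space, second_countable_topology}, 'e::real_normed_vector) chart set"
    and g :: "'m \<Rightarrow> 'e \<Rightarrow> 'e \<Rightarrow> real"
    and R :: "'m \<Rightarrow> 'e \<Rightarrow> 'm"
    and f :: "'m \<Rightarrow> real"
    and c1 c2 :: real
    and x :: "nat \<Rightarrow> 'm" and \<eta> :: "nat \<Rightarrow> 'e" and \<alpha> \<beta> :: "nat \<Rightarrow> real"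
  assumes "riemannian_manifold A g"
    and "retraction_on_manifold A R"
    and "bdd_below (range f)"
    and "C1_function A f"
    and "\<exists>L>0. \<forall>p v t. tnorm g p v = 1 \<longrightarrow> t \<ge> 0 \<longrightarrow>
           \<bar>frechet_derivative (f \<circ> R p) (at (t *\<^sub>R v)) v - frechet_derivative (f \<circ> R p) (at 0) v\<bar> \<le> L * t"
    and "0 < c1" and "c1 < c2" and "c2 < 1"
    and "scaled_DY_sequence A g R f c1 c2 x \<eta> \<alpha> \<beta>"
  shows "liminf (\<lambda>k. ereal (tnorm g (x k) (grad A g f (x k)))) = 0"
proof -
  have met: "riemannian_metric A g"
    using assms(1) by (simp add: riemannian_manifold_def)
  define G where "G k = grad A g f (x k)" for k
  define T where "T k = DY_transport A g R (x k) (\<alpha> k) (\<eta> k)" for k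
  have \<eta>0: "\<eta> 0 = - G 0"
    and step: "\<alpha> k > 0" "weak_wolfe A g R f c1 c2 (x k) (\<eta> k) (\<alpha> k)"
      "x (Suc k) = R (x k) (\<alpha> k *\<^sub>R \<eta> k)"
      "\<eta> (Suc k) = - G (Suc k) + \<beta> (Suc k) *\<^sub>R T k"
      "\<beta> (Suc k) = (if G (Suc k) = 0 then 0 else (tnorm g (x (Suc k)) (G (Suc k)))\<^sup>2 /
                  (g (x (Suc k)) (G (Suc k)) (T k) - g (x k) (G k) (\<eta> k)))" for k
    using assms(9) unfolding scaled_DY_sequence_def G_def T_def by blast+
  show ?thesis
  \<comment> \<open>By the convention for zero gradients, the iteration is stationary once a
    gradient vanishes; otherwise every \<beta> is given by the quotient.\<close>
  proof (cases "\<exists>K. G K = 0")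
    case True
    then obtain K where K: "G K = 0" ..
    have \<eta>_zero: "\<eta> k = 0" if "G k = 0" for k
      using that by (cases k) (auto simp: \<eta>0 step(4,5))
    have G_zero: "G (K + n) = 0" for n
    proof (induction n)
      case (Suc n)
      have "x (Suc (K + n)) = x (K + n)"
        using assms(2) \<eta>_zero[OF Suc] by (simp add: step(3) retraction_on_manifold_def)
      with Suc show ?case by (simp add: G_def)
    qed (simp add: K)
    have "\<forall>\<^sub>F k in sequentially. ereal (tnorm g (x k) (G k)) = 0"
      using G_zero tnorm_facts(3)[OF met]
      by (auto simp: eventually_sequentially le_iff_add zero_ereal_def intro!: exI[of _ K])
    then have "(\<lambda>k. ereal (tnorm g (x k) (G k))) \<longlonglongrightarrow> 0"
      by (rule tendsto_eventually)
    then show ?thesis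
      by (simp add: G_def lim_imp_Liminf)
  next
    case False
    then have nz: "G k \<noteq> 0" for k by blast
    obtain L where "L > 0" and lip: "\<And>p v t. tnorm g p v = 1 \<Longrightarrow> t \<ge> 0 \<Longrightarrow>
        \<bar>frechet_derivative (f \<circ> R p) (at (t *\<^sub>R v)) v - frechet_derivative (f \<circ> R p) (at 0) v\<bar> \<le> L * t"
      using assms(5) by blast
    obtain m where m: "\<And>y. m \<le> f y"
      using assms(3) by (auto simp: bdd_below_def)
    have c2: "c2 > 0" using assms(6,7) by simp
    have \<beta>: "\<beta> (Suc k) = (tnorm g (x (Suc k)) (G (Suc k)))\<^sup>2 /
                  (g (x (Suc k)) (G (Suc k)) (T k) - g (x k) (G k) (\<eta> k))" for k
      using nz by (simp add: step(5))
    \<comment> \<open>Only descent at \<open>k\<close> remains as a premise, so the first conclusion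
      is the induction step for descent.\<close>
    note DY = DY_step[OF met c2 assms(8) step(2) _ step(3), folded G_def,
        OF _ nz T_def \<beta> step(4)]
    have descent: "g (x k) (G k) (\<eta> k) < 0" for k
    proof (induction k)
      case 0
      have "g (x 0) (G 0) (\<eta> 0) = - g (x 0) (G 0) (G 0)"
        using met by (simp add: \<eta>0 riemannian_metric_def bilinear_rneg)
      with nz[of 0] met show ?case by (simp add: riemannian_metric_def)
    qed (rule DY(1))
    have "\<eta> k \<noteq> 0" for k
      using descent[of k] bilinear_rzero[of "g (x k)" "G k"] met by (auto simp: riemannian_metric_def)
    then have \<eta>pos: "g (x k) (\<eta> k) (\<eta> k) > 0" for k
      using met by (simp add: riemannian_metric_def)
    show ?thesis
    \<comment> \<open>Here \<open>F\<close> is \<open>f\<close> along the iterates, \<open>a\<close>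
      is the squared norm of \<eta> over the squared slope, and \<open>h\<close> is the gradient
      norm.\<close>
    proof (rule liminf_zero_of_decrease)
      show "c1 * (1 - c2) / L > 0"
        using assms(6,8) \<open>L > 0\<close> by simp
      show "m \<le> f (x k)" for k by (rule m)
      show "f (x (Suc k)) \<le> f (x k) -
          c1 * (1 - c2) / L / (g (x k) (\<eta> k) (\<eta> k) / (g (x k) (G k) (\<eta> k))\<^sup>2)" for k
        using weak_wolfe_decrease[OF assms(1,2,4) \<open>L > 0\<close> lip assms(6) step(1,2)]
          descent by (simp add: G_def step(3))
      show "g (x k) (\<eta> k) (\<eta> k) / (g (x k) (G k) (\<eta> k))\<^sup>2 > 0" for k
        using \<eta>pos[of k] descent[of k] by (intro divide_pos_pos) auto
      show "0 \<le> tnorm g (x k) (grad A g f (x k))" for k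
        by (rule tnorm_facts(2)[OF met])
      show "g (x (Suc k)) (\<eta> (Suc k)) (\<eta> (Suc k)) / (g (x (Suc k)) (G (Suc k)) (\<eta> (Suc k)))\<^sup>2
          \<le> g (x k) (\<eta> k) (\<eta> k) / (g (x k) (G k) (\<eta> k))\<^sup>2
            + 1 / (tnorm g (x (Suc k)) (grad A g f (x (Suc k))))\<^sup>2" for k
        using DY(2)[OF descent] by (simp add: G_def)
    qed
  qed
qed

end
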